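(* Let $(H,\rho)$ be a complete CAT(0) space and let $A:H\rightrightarrows TH$ be a monotone vector field satisfying the surjectivity condition. For $\lambda>0$ let $J_\lambda:H\rightrightarrows H$, $J_\lambda x:=\{z\in H:\lambda^{-1}\rho(z,x)\gamma_{z,x}\in Az\}$, be the $\lambda$-resolvent of $A$. Then for every $\lambda>0$: (i) $J_\lambda x$ is nonempty for every $x\in H$ and is single-valued (so $J_\lambda$ is regarded as a map $H\to H$ in what follows); (ii) $J_\lambda$ is nonexpansive; (iii) $\operatorname{Fix}(J_\lambda)=A^{-1}(\mathbf 0)$; (iv) if $0<\mu\le\lambda$, then for each $x\in H$, $J_\lambda(x)=J_\mu(u)$ with $u:=\left(1-\frac{\mu}{\lambda}\right)J_\lambda(x)\oplus\frac{\mu}{\lambda}x$; (v) $J_\lambda$ is firmly nonexpansive, i.e. for all $x,y\in H$ the function $t\mapsto\rho(\gamma_{x,J_\lambda x}(t),\gamma_{y,J_\lambda y}(t))$ is nonincreasing on $[0,1]$.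
   Context: Geodesics. In a complete CAT(0) space $(H,\rho)$, $\gamma_{x,y}:[0,1]\to H$ denotes the unique geodesic from $x$ to $y$ parametrized with constant speed $\rho(x,y)$, and $(1-t)x\oplus ty:=\gamma_{x,y}(t)$; $\gamma_{x,y}$ is called a zero geodesic if $x=y$. For a normalized geodesic $\gamma$ (i.e. parametrized on $[0,1]$ with constant speed), $\zeta(\gamma)=0$ if $\gamma$ is a zero geodesic and $\zeta(\gamma)=1$ otherwise. Tangent spaces. For $q,r\ne p$, the comparison angle $\overline\angle_p(q,r)$ is the angle at $\bar p$ in a Euclidean triangle $\bar p\bar q\bar r$ with the same side lengths as $p,q,r$; set $\overline\angle_p(p,p)=0$ and $\overline\angle_p(p,r)=\overline\angle_p(r,p)=\pi/2$ for $r\neq p$. The Alexandrov angle of geodesics $\gamma_1,\gamma_2$ issuing from $p$ is $\alpha_p(\gamma_1,\gamma_2)=\lim_{s,t\to0^+}\overline\angle_p(\gamma_1(s),\gamma_2(t))$. $S_p$ is the set of normalized geodesics issuing from $p$, modulo the relation $\alpha_p=0$, with induced metric $\angle_p$. $T_pH=([0,\infty)\times S_p)/\!\sim$, where $(t_1,\gamma_1)\sim(t_2,\gamma_2)$ iff either $t_1\zeta(\gamma_1)=t_2\zeta(\gamma_2)=0$, or $t_1\zeta(\gamma_1)=t_2\zeta(\gamma_2)>0$ and $\gamma_1=\gamma_2$ in $S_p$. The class of $(t,\gamma)$ is written $t\gamma$, and $\gamma$ stands for $1\gamma$. Put $0_p=0\gamma$ (also equal to $t\gamma_{p,p}$) and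 $g_p(t_1\gamma_1,t_2\gamma_2)=t_1t_2\zeta(\gamma_1)\zeta(\gamma_2)\cos\angle_p(\gamma_1,\gamma_2)$. $TH=\bigcup_{p\in H}T_pH$. Vector fields. A vector field is a set-valued map $A:H\rightrightarrows TH$ with $Ap\subset T_pH$ for all $p$ (possibly empty); $A^{-1}(\mathbf 0)=\{p\in H: 0_p\in Ap\}$. $A$ is monotone if $g_p(\eta,\gamma_{p,q})\le -g_q(\nu,\gamma_{q,p})$ whenever $\eta\in Ap$, $\nu\in Aq$. $A$ satisfies the surjectivity condition if for all $t>0$ and $x\in H$ there is $p\in H$ with $t\rho(p,x)\gamma_{p,x}\in Ap$. A map is nonexpansive if it is $1$-Lipschitz; $\operatorname{Fix}(T)=\{x:Tx=x\}$. *)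

theory Defs
  imports "HOL-Analysis.Analysis"
begin

section \<open>Geodesics and CAT(0) spaces\<close>

text \<open>
  A normalized geodesic is a map on $[0,1]$. It is represented by a function that is
  \<^const>\<open>extensional\<close> on $[0,1]$, so that equality of maps on $[0,1]$ is equality in HOL.
\<close>

definition (in metric_space) normalized_geodesic :: "(real \<Rightarrow> 'a) \<Rightarrow> bool" where
  "normalized_geodesic \<gamma> \<longleftrightarrow>
     \<gamma> \<in> extensional {0..1} \<and>
     (\<exists>l. \<forall>s\<in>{0..1}. \<forall>t\<in>{0..1}. dist (\<gamma> s) (\<gamma> t) = l * \<bar>s - t\<bar>)"

definition (in metric_space) geodesic_from_to :: "(real \<Rightarrow> 'a) \<Rightarrow> 'a \<Rightarrow> 'a \<Rightarrow> bool" where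
  "geodesic_from_to \<gamma> x y \<longleftrightarrow> normalized_geodesic \<gamma> \<and> \<gamma> 0 = x \<and> \<gamma> 1 = y"

definition (in metric_space) comparison_triangle ::
    "real^2 \<Rightarrow> real^2 \<Rightarrow> real^2 \<Rightarrow> 'a \<Rightarrow> 'a \<Rightarrow> 'a \<Rightarrow> bool" where
  "comparison_triangle P Q R p q r \<longleftrightarrow>
     norm (P - Q) = dist p q \<and> norm (P - R) = dist p r \<and> norm (Q - R) = dist q r"

text \<open>
  In the comparison axiom the two points lie on the sides issuing from \<open>p\<close>. Since \<open>p\<close>, \<open>q\<close>, \<open>r\<close>
  are arbitrary and geodesics can be reversed, this covers every pair of sides of a geodesic
  triangle; two points on the same side have the same distance as their comparison points.
\<close>

class cat0_space = metric_space +
  assumes geodesic_exists: "\<exists>\<gamma>. geodesic_from_to \<gamma> x y"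
    and cat0_inequality:
      "\<lbrakk>geodesic_from_to \<gamma> p q; geodesic_from_to \<delta> p r; comparison_triangle P Q R p q r;
        0 \<le> s; s \<le> 1; 0 \<le> t; t \<le> 1\<rbrakk> \<Longrightarrow>
       dist (\<gamma> s) (\<delta> t) \<le> norm (((1 - s) *\<^sub>R P + s *\<^sub>R Q) - ((1 - t) *\<^sub>R P + t *\<^sub>R R))"

text \<open>
  \<open>geodesic x y t\<close> is the point $(1-t)x \oplus ty$.
\<close>

definition geodesic :: "'a::cat0_space \<Rightarrow> 'a \<Rightarrow> real \<Rightarrow> 'a" where
  "geodesic x y = (THE \<gamma>. geodesic_from_to \<gamma> x y)"

definition zeta :: "(real \<Rightarrow> 'a) \<Rightarrow> real" where
  "zeta \<gamma> = (if \<gamma> 0 = \<gamma> 1 then 0 else 1)"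


section \<open>Angles\<close>

definition euclidean_angle :: "real^2 \<Rightarrow> real^2 \<Rightarrow> real^2 \<Rightarrow> real" where
  "euclidean_angle P Q R = arccos (((Q - P) \<bullet> (R - P)) / (norm (Q - P) * norm (R - P)))"

definition comparison_angle :: "'a::metric_space \<Rightarrow> 'a \<Rightarrow> 'a \<Rightarrow> real" where
  "comparison_angle p q r =
     (if q = p \<and> r = p then 0
      else if q = p \<or> r = p then pi / 2
      else (THE \<theta>. \<exists>P Q R. comparison_triangle P Q R p q r \<and> \<theta> = euclidean_angle P Q R))"

definition alexandrov_angle :: "'a::metric_space \<Rightarrow> (real \<Rightarrow> 'a) \<Rightarrow> (real \<Rightarrow> 'a) \<Rightarrow> real" where
  "alexandrov_angle p \<gamma>\<^sub>1 \<gamma>\<^sub>2 =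
     Lim (at_right 0 \<times>\<^sub>F at_right 0) (\<lambda>(s, t). comparison_angle p (\<gamma>\<^sub>1 s) (\<gamma>\<^sub>2 t))"


section \<open>Tangent spaces\<close>

definition geodesics_from :: "'a::metric_space \<Rightarrow> (real \<Rightarrow> 'a) set" where
  "geodesics_from p = {\<gamma>. normalized_geodesic \<gamma> \<and> \<gamma> 0 = p}"

definition direction_rel :: "'a::metric_space \<Rightarrow> ((real \<Rightarrow> 'a) \<times> (real \<Rightarrow> 'a)) set" where
  "direction_rel p = {(\<gamma>\<^sub>1, \<gamma>\<^sub>2). \<gamma>\<^sub>1 \<in> geodesics_from p \<and> \<gamma>\<^sub>2 \<in> geodesics_from p \<and>
     alexandrov_angle p \<gamma>\<^sub>1 \<gamma>\<^sub>2 = 0}"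

type_synonym 'a direction = "(real \<Rightarrow> 'a) set"

definition directions :: "'a::metric_space \<Rightarrow> 'a direction set" where
  "directions p = geodesics_from p // direction_rel p"

text \<open>
  Functions on quotients are obtained from representatives as the unique element of the set of
  values at all representatives.
\<close>

definition direction_angle :: "'a::metric_space \<Rightarrow> 'a direction \<Rightarrow> 'a direction \<Rightarrow> real" where
  "direction_angle p c\<^sub>1 c\<^sub>2 = the_elem (\<Union>\<gamma>\<^sub>1\<in>c\<^sub>1. \<Union>\<gamma>\<^sub>2\<in>c\<^sub>2. {alexandrov_angle p \<gamma>\<^sub>1 \<gamma>\<^sub>2})"

definition direction_zeta :: "'a direction \<Rightarrow> real" where
  "direction_zeta c = the_elem (\<Union>\<gamma>\<in>c. {zeta \<gamma>})"

type_synonym 'a tangent = "(real \<times> 'a direction) set"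

definition tangent_rel ::
    "'a::metric_space \<Rightarrow> ((real \<times> 'a direction) \<times> (real \<times> 'a direction)) set" where
  "tangent_rel p = {((t\<^sub>1, c\<^sub>1), (t\<^sub>2, c\<^sub>2)).
     (t\<^sub>1, c\<^sub>1) \<in> {0..} \<times> directions p \<and> (t\<^sub>2, c\<^sub>2) \<in> {0..} \<times> directions p \<and>
     (t\<^sub>1 * direction_zeta c\<^sub>1 = 0 \<and> t\<^sub>2 * direction_zeta c\<^sub>2 = 0 \<or>
      t\<^sub>1 * direction_zeta c\<^sub>1 = t\<^sub>2 * direction_zeta c\<^sub>2 \<and> t\<^sub>1 * direction_zeta c\<^sub>1 > 0 \<and> c\<^sub>1 = c\<^sub>2)}"

definition tangent_space :: "'a::metric_space \<Rightarrow> 'a tangent set" where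
  "tangent_space p = ({0..} \<times> directions p) // tangent_rel p"

text \<open>
  \<open>tangent p t \<gamma>\<close> is the element $t\gamma$ of $T_pH$.
\<close>

definition tangent :: "'a::metric_space \<Rightarrow> real \<Rightarrow> (real \<Rightarrow> 'a) \<Rightarrow> 'a tangent" where
  "tangent p t \<gamma> = tangent_rel p `` {(t, direction_rel p `` {\<gamma>})}"

definition zero_tangent :: "'a::cat0_space \<Rightarrow> 'a tangent" where
  "zero_tangent p = tangent p 0 (geodesic p p)"

definition tangent_inner :: "'a::metric_space \<Rightarrow> 'a tangent \<Rightarrow> 'a tangent \<Rightarrow> real" where
  "tangent_inner p \<eta> \<nu> = the_elem (\<Union>(t\<^sub>1, c\<^sub>1)\<in>\<eta>. \<Union>(t\<^sub>2, c\<^sub>2)\<in>\<nu>.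
     {t\<^sub>1 * t\<^sub>2 * direction_zeta c\<^sub>1 * direction_zeta c\<^sub>2 * cos (direction_angle p c\<^sub>1 c\<^sub>2)})"


section \<open>Vector fields and resolvents\<close>

definition vector_field :: "('a::metric_space \<Rightarrow> 'a tangent set) \<Rightarrow> bool" where
  "vector_field A \<longleftrightarrow> (\<forall>p. A p \<subseteq> tangent_space p)"

definition zeros :: "('a::cat0_space \<Rightarrow> 'a tangent set) \<Rightarrow> 'a set" where
  "zeros A = {p. zero_tangent p \<in> A p}"

definition monotone_field :: "('a::cat0_space \<Rightarrow> 'a tangent set) \<Rightarrow> bool" where
  "monotone_field A \<longleftrightarrow> (\<forall>p q. \<forall>\<eta>\<in>A p. \<forall>\<nu>\<in>A q.
     tangent_inner p \<eta> (tangent p 1 (geodesic p q))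
       \<le> - tangent_inner q \<nu> (tangent q 1 (geodesic q p)))"

definition surjectivity_condition :: "('a::cat0_space \<Rightarrow> 'a tangent set) \<Rightarrow> bool" where
  "surjectivity_condition A \<longleftrightarrow>
     (\<forall>t>0. \<forall>x. \<exists>p. tangent p (t * dist p x) (geodesic p x) \<in> A p)"

definition resolvent :: "('a::cat0_space \<Rightarrow> 'a tangent set) \<Rightarrow> real \<Rightarrow> 'a \<Rightarrow> 'a set" where
  "resolvent A r x = {z. tangent z (inverse r * dist z x) (geodesic z x) \<in> A z}"

text \<open>
  The resolvent as a point-valued map, meaningful where its values are singletons.
\<close>

definition resolvent_map :: "('a::cat0_space \<Rightarrow> 'a tangent set) \<Rightarrow> real \<Rightarrow> 'a \<Rightarrow> 'a" where
  "resolvent_map A r x = the_elem (resolvent A r x)"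

definition nonexpansive :: "('a::metric_space \<Rightarrow> 'a) \<Rightarrow> bool" where
  "nonexpansive T \<longleftrightarrow> 1-lipschitz_on UNIV T"

definition firmly_nonexpansive :: "('a::cat0_space \<Rightarrow> 'a) \<Rightarrow> bool" where
  "firmly_nonexpansive T \<longleftrightarrow>
     (\<forall>x y. antimono_on {0..1} (\<lambda>t. dist (geodesic x (T x) t) (geodesic y (T y) t)))"

definition Fix :: "('a \<Rightarrow> 'a) \<Rightarrow> 'a set" where
  "Fix T = {x. T x = x}"

end

theory Submission
  imports Defs
begin

text \<open>
  Let $z \in J_\lambda x$ and $w \in J_\lambda y$. Monotonicity says that
  $\rho(z,x)\cos\angle_z(x,w) + \rho(w,y)\cos\angle_w(y,z) \le 0$. Adding the CAT(0) law of cosines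
  at $z$ and at $w$ yields
  $\rho(x,w)^2 + \rho(y,z)^2 \ge \rho(z,x)^2 + \rho(w,y)^2 + 2\rho(z,w)^2$, and comparison with the
  quadrilateral inequality gives $\rho(z,w) \le \rho(x,y)$. This is uniqueness for $x = y$ and
  nonexpansiveness in general. Part (iv) holds because an initial segment of a geodesic has the same
  direction. Firm nonexpansiveness follows by convexity of
  $f(t) = \rho(\gamma_{x,J_\lambda x}(t),\gamma_{y,J_\lambda y}(t))$, since $f(1) \le f(s)$ is
  nonexpansiveness of $J_{(1-s)\lambda}$ by (iv).
\<close>

section \<open>Geodesics in CAT(0) spaces\<close>

lemma comparison_triangle_exists:
  fixes p q r :: "'a::metric_space"
  shows "\<exists>P Q R. comparison_triangle P Q R p q r"
proof -
  define a b c where abc: "a = dist p q" "b = dist p r" "c = dist q r"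
  have tri: "a \<ge> 0" "b \<ge> 0" "c \<ge> 0" "a \<le> b + c" "b \<le> a + c" "c \<le> a + b"
    unfolding abc by (simp_all add: dist_triangle dist_triangle2 dist_triangle3)
  have nv: "norm (vector [x, y] :: real^2) = sqrt (x\<^sup>2 + y\<^sup>2)" for x y
    by (simp add: norm_eq_sqrt_inner inner_vec_def sum_2 power2_eq_square)
  have dv: "(vector [x, y] :: real^2) - vector [u, v] = vector [x - u, y - v]" for x y u v
    by (simp add: vec_eq_iff forall_2)
  obtain x y :: real where xy: "x\<^sup>2 + y\<^sup>2 = b\<^sup>2" "(a - x)\<^sup>2 + y\<^sup>2 = c\<^sup>2"
  proof (cases "a = 0")
    case True
    then show ?thesis using that[of b 0] tri by (simp add: power2_eq_iff)
  next
    case False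
    \<comment> \<open>With P at the origin and Q at (a, 0), the law of cosines forces this first
      coordinate of R.\<close>
    define x where "x = (a\<^sup>2 + b\<^sup>2 - c\<^sup>2) / (2 * a)"
    have ax: "2 * a * x = a\<^sup>2 + b\<^sup>2 - c\<^sup>2" using False by (simp add: x_def)
    \<comment> \<open>The triangle inequalities bound |2ax| by 2ab. Hence
      \<open>b\<^sup>2 - x\<^sup>2\<close> is nonnegative and its square root can serve as second
      coordinate.\<close>
    have "(a - b)\<^sup>2 \<le> c\<^sup>2" using tri by (intro iffD2[OF abs_le_square_iff[symmetric]]) auto
    moreover have "c\<^sup>2 \<le> (a + b)\<^sup>2" using tri by (intro power_mono) auto
    ultimately have "\<bar>2 * a * x\<bar> \<le> 2 * a * b"
      unfolding ax by (auto simp: power2_eq_square algebra_simps abs_le_iff)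
    then have "\<bar>x\<bar> \<le> \<bar>b\<bar>" using tri False by (simp add: abs_mult)
    then have "x\<^sup>2 \<le> b\<^sup>2" by (simp only: abs_le_square_iff)
    then have "x\<^sup>2 + (sqrt (b\<^sup>2 - x\<^sup>2))\<^sup>2 = b\<^sup>2" "(a - x)\<^sup>2 + (sqrt (b\<^sup>2 - x\<^sup>2))\<^sup>2 = c\<^sup>2"
      using ax by (auto simp: power2_eq_square algebra_simps)
    then show ?thesis by (rule that)
  qed
  have "comparison_triangle (vector [0, 0]) (vector [a, 0]) (vector [x, y]) p q r"
    using xy tri by (simp add: comparison_triangle_def dv nv flip: abc)
  then show ?thesis by blast
qed

lemma comparison_triangle_inner:
  assumes "comparison_triangle P Q R p q r"
  shows "2 * ((Q - P) \<bullet> (R - P)) = (dist p q)\<^sup>2 + (dist p r)\<^sup>2 - (dist q r)\<^sup>2"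
proof -
  have "(norm ((Q - P) - (R - P)))\<^sup>2 = (norm (Q - P))\<^sup>2 + (norm (R - P))\<^sup>2 - 2 * ((Q - P) \<bullet> (R - P))"
    by (simp only: power2_norm_eq_inner inner_diff_left[of "Q - P" "R - P"]
        inner_diff_right[of _ "Q - P" "R - P"] inner_commute[of "R - P" "Q - P"])
  then show ?thesis using assms by (simp add: comparison_triangle_def norm_minus_commute)
qed

text \<open>The comparison points are P + s(Q - P) and P + t(R - P). Expanding the squared norm of
  their difference and writing the inner product through the side lengths removes the plane
  triangle, so later comparisons become algebra in distances.\<close>

lemma cat0_square_inequality:
  fixes p :: "'a::cat0_space"
  assumes "geodesic_from_to \<gamma> p q" "geodesic_from_to \<delta> p r" "s \<in> {0..1}" "t \<in> {0..1}"
  shows "(dist (\<gamma> s) (\<delta> t))\<^sup>2 \<le> s\<^sup>2 * (dist p q)\<^sup>2 + t\<^sup>2 * (dist p r)\<^sup>2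
    - s * t * ((dist p q)\<^sup>2 + (dist p r)\<^sup>2 - (dist q r)\<^sup>2)"
proof -
  obtain P Q R where T: "comparison_triangle P Q R p q r"
    using comparison_triangle_exists by blast
  let ?v = "((1 - s) *\<^sub>R P + s *\<^sub>R Q) - ((1 - t) *\<^sub>R P + t *\<^sub>R R)"
  have v: "?v = s *\<^sub>R (Q - P) - t *\<^sub>R (R - P)" by (simp add: algebra_simps)
  have sq: "(norm (s *\<^sub>R u - t *\<^sub>R w))\<^sup>2
      = s\<^sup>2 * (norm u)\<^sup>2 + t\<^sup>2 * (norm w)\<^sup>2 - s * t * (2 * (u \<bullet> w))" for u w :: "real^2"
    unfolding power2_norm_eq_inner
    by (simp add: inner_diff_left inner_diff_right inner_commute[of w u] power2_eq_square)
      algebra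
  have "dist (\<gamma> s) (\<delta> t) \<le> norm ?v"
    using assms(3,4) by (intro cat0_inequality[OF assms(1,2) T]) simp_all
  then have "(dist (\<gamma> s) (\<delta> t))\<^sup>2 \<le> (norm ?v)\<^sup>2" by (intro power_mono) simp_all
  moreover have "norm (Q - P) = dist p q" "norm (R - P) = dist p r"
    using T by (simp_all add: comparison_triangle_def norm_minus_commute)
  ultimately show ?thesis
    by (simp only: v sq comparison_triangle_inner[OF T])
qed

section \<open>Uniqueness, restriction and reversal of geodesics\<close>

lemma normalized_geodesic_dist:
  assumes "normalized_geodesic \<gamma>" "s \<in> {0..1}" "t \<in> {0..1}"
  shows "dist (\<gamma> s) (\<gamma> t) = dist (\<gamma> 0) (\<gamma> 1) * \<bar>s - t\<bar>"
proof -
  obtain l where l: "\<And>s t. s \<in> {0..1} \<Longrightarrow> t \<in> {0..1} \<Longrightarrow> dist (\<gamma> s) (\<gamma> t) = l * \<bar>s - t\<bar>"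
    using assms unfolding normalized_geodesic_def by blast
  show ?thesis using l[of 0 1] l[OF assms(2,3)] by simp
qed

text \<open>For q = r and s = t the right-hand side of \<open>cat0_square_inequality\<close>
  collapses to zero, so the maps agree on [0,1]; extensionality then gives equality of
  functions.\<close>

lemma geodesic_from_to_unique:
  fixes x :: "'a::cat0_space"
  assumes "geodesic_from_to \<gamma> x y" "geodesic_from_to \<delta> x y"
  shows "\<gamma> = \<delta>"
proof (rule extensionalityI)
  show "\<gamma> \<in> extensional {0..1}" "\<delta> \<in> extensional {0..1}"
    using assms by (simp_all add: geodesic_from_to_def normalized_geodesic_def)
  show "\<gamma> t = \<delta> t" if "t \<in> {0..1}" for t
  proof -
    have "(dist (\<gamma> t) (\<delta> t))\<^sup>2 \<le> 0"
      using cat0_square_inequality[OF assms that that] by (simp add: power2_eq_square)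
    then show ?thesis by simp
  qed
qed

lemma geodesic_from_to_geodesic:
  fixes x :: "'a::cat0_space"
  shows "geodesic_from_to (geodesic x y) x y"
proof -
  obtain \<gamma> where \<gamma>: "geodesic_from_to \<gamma> x y" using geodesic_exists by blast
  show ?thesis unfolding geodesic_def
    by (rule theI[of _ \<gamma>]) (rule \<gamma>, rule geodesic_from_to_unique[OF _ \<gamma>])
qed

lemma geodesic_eqI:
  fixes x :: "'a::cat0_space"
  assumes "geodesic_from_to \<gamma> x y"
  shows "geodesic x y = \<gamma>"
  by (rule geodesic_from_to_unique[OF geodesic_from_to_geodesic assms])

lemma geodesic_0 [simp]: "geodesic x y 0 = x"
  and geodesic_1 [simp]: "geodesic x y 1 = y"
  and normalized_geodesic_geodesic: "normalized_geodesic (geodesic x y)"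
  using geodesic_from_to_geodesic[of x y] by (simp_all add: geodesic_from_to_def)

lemma geodesic_in_geodesics_from: "geodesic x y \<in> geodesics_from x"
  by (simp add: geodesics_from_def normalized_geodesic_geodesic)

text \<open>An affine change of parameter multiplies the speed by |b - a|. Taking
  \<open>a = 1\<close>, \<open>b = 0\<close> gives reversal and \<open>a = 0\<close> an initial
  segment; the restriction to [0,1] keeps the map extensional.\<close>

lemma geodesic_from_to_subsegment:
  assumes "normalized_geodesic \<gamma>" "a \<in> {0..1}" "b \<in> {0..1}"
  shows "geodesic_from_to (\<lambda>t\<in>{0..1}. \<gamma> ((1 - t) * a + t * b)) (\<gamma> a) (\<gamma> b)"
proof -
  have in01: "(1 - t) * a + t * b \<in> {0..1}" if "t \<in> {0..1}" for t
    using convexD_alt[of "{0..1::real}" a b t] assms that by simp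
  have "dist (\<gamma> ((1 - s) * a + s * b)) (\<gamma> ((1 - t) * a + t * b))
      = dist (\<gamma> 0) (\<gamma> 1) * \<bar>b - a\<bar> * \<bar>s - t\<bar>"
    if "s \<in> {0..1}" "t \<in> {0..1}" for s t
  proof -
    have "(1 - s) * a + s * b - ((1 - t) * a + t * b) = (b - a) * (s - t)"
      by (simp add: algebra_simps)
    then show ?thesis
      using normalized_geodesic_dist[OF assms(1) in01[OF that(1)] in01[OF that(2)]]
      by (simp add: abs_mult)
  qed
  then show ?thesis by (auto simp: geodesic_from_to_def normalized_geodesic_def)
qed

lemma geodesic_subsegment:
  fixes x :: "'a::cat0_space"
  assumes "a \<in> {0..1}" "b \<in> {0..1}" "t \<in> {0..1}"
  shows "geodesic (geodesic x y a) (geodesic x y b) t = geodesic x y ((1 - t) * a + t * b)"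
  unfolding geodesic_eqI[OF geodesic_from_to_subsegment[OF normalized_geodesic_geodesic assms(1,2)]]
  by (rule restrict_apply'[OF assms(3)])

lemma geodesic_reverse:
  fixes x :: "'a::cat0_space"
  assumes "t \<in> {0..1}"
  shows "geodesic y x t = geodesic x y (1 - t)"
  using geodesic_subsegment[of 1 0 t x y] assms by simp

lemma dist_geodesic:
  fixes x :: "'a::cat0_space"
  assumes "s \<in> {0..1}" "t \<in> {0..1}"
  shows "dist (geodesic x y s) (geodesic x y t) = dist x y * \<bar>s - t\<bar>"
  using normalized_geodesic_dist[OF normalized_geodesic_geodesic assms, of x y] by simp

section \<open>Convexity of the metric and the quadrilateral inequality\<close>

lemma dist_geodesic_same_start:
  fixes x :: "'a::cat0_space"
  assumes "t \<in> {0..1}"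
  shows "dist (geodesic x y t) (geodesic x z t) \<le> t * dist y z"
proof (rule power2_le_imp_le)
  have "(dist (geodesic x y t) (geodesic x z t))\<^sup>2 \<le> t\<^sup>2 * (dist x y)\<^sup>2 + t\<^sup>2 * (dist x z)\<^sup>2
      - t * t * ((dist x y)\<^sup>2 + (dist x z)\<^sup>2 - (dist y z)\<^sup>2)"
    by (rule cat0_square_inequality[OF geodesic_from_to_geodesic geodesic_from_to_geodesic assms assms])
  \<comment> \<open>Equal parameters on both sides make the terms in \<open>dist x y\<close> and
    \<open>dist x z\<close> cancel.\<close>
  also have "\<dots> = (t * dist y z)\<^sup>2" by algebra
  finally show "(dist (geodesic x y t) (geodesic x z t))\<^sup>2 \<le> (t * dist y z)\<^sup>2" .
  show "0 \<le> t * dist y z" using assms by simp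
qed

text \<open>The diagonal from x to y' splits the quadrilateral into two triangles, one with common
  start x and one with common end y'. The second reduces to the first kind by reversal.\<close>

lemma dist_geodesic_convex:
  fixes x :: "'a::cat0_space"
  assumes "t \<in> {0..1}"
  shows "dist (geodesic x x' t) (geodesic y y' t) \<le> (1 - t) * dist x y + t * dist x' y'"
proof -
  have "dist (geodesic x y' t) (geodesic y y' t) \<le> (1 - t) * dist x y"
    unfolding geodesic_reverse[OF assms, of x y'] geodesic_reverse[OF assms, of y y']
    using assms by (intro dist_geodesic_same_start) simp
  moreover have "dist (geodesic x x' t) (geodesic x y' t) \<le> t * dist x' y'"
    by (rule dist_geodesic_same_start[OF assms])
  moreover have "dist (geodesic x x' t) (geodesic y y' t)
      \<le> dist (geodesic x x' t) (geodesic x y' t) + dist (geodesic x y' t) (geodesic y y' t)"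
    by (rule dist_triangle)
  ultimately show ?thesis by linarith
qed

text \<open>The midpoint m of the diagonal from x to w is compared with both z and y. The other
  diagonal is at most the detour through m, whose square is at most twice the sum of the two
  squares.\<close>

lemma quadrilateral_inequality:
  fixes x y z w :: "'a::cat0_space"
  shows "(dist x w)\<^sup>2 + (dist z y)\<^sup>2 \<le> (dist x z)\<^sup>2 + (dist z w)\<^sup>2 + (dist w y)\<^sup>2 + (dist y x)\<^sup>2"
proof -
  define m where "m = geodesic x w (1/2)"
  \<comment> \<open>The Bruhat-Tits midpoint inequality: the square inequality with parameter 1 on
    the side to v and 1/2 on the side to w.\<close>
  have mid: "4 * (dist v m)\<^sup>2 \<le> 2 * (dist x v)\<^sup>2 + 2 * (dist v w)\<^sup>2 - (dist x w)\<^sup>2" for v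
  proof -
    have "(dist (geodesic x v 1) m)\<^sup>2 \<le> 1\<^sup>2 * (dist x v)\<^sup>2 + (1/2)\<^sup>2 * (dist x w)\<^sup>2
      - 1 * (1/2) * ((dist x v)\<^sup>2 + (dist x w)\<^sup>2 - (dist v w)\<^sup>2)"
      unfolding m_def
      by (rule cat0_square_inequality[OF geodesic_from_to_geodesic geodesic_from_to_geodesic]) simp_all
    also have "(1/2 :: real)\<^sup>2 = 1/4" by (simp add: power2_eq_square)
    finally show ?thesis by (simp add: add_divide_distrib diff_divide_distrib)
  qed
  have "(dist z y)\<^sup>2 \<le> (dist z m + dist y m)\<^sup>2"
    by (intro power_mono dist_triangle2 zero_le_dist)
  also have "\<dots> \<le> 2 * (dist z m)\<^sup>2 + 2 * (dist y m)\<^sup>2"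
    using sum_squares_bound[of "dist z m" "dist y m"] unfolding power2_sum by linarith
  finally show ?thesis
    using mid[of z] mid[of y] unfolding dist_commute[of w y] dist_commute[of y x] by linarith
qed

section \<open>Alexandrov angles\<close>

text \<open>The cosine of the comparison angle, by the law of cosines. It is rational in the
  distances, so monotonicity and limits are treated here before \<open>arccos\<close> is applied. If
  q or r equals p, division by zero gives the value 0.\<close>

definition comparison_cos :: "'a::metric_space \<Rightarrow> 'a \<Rightarrow> 'a \<Rightarrow> real" where
  "comparison_cos p q r =
     ((dist p q)\<^sup>2 + (dist p r)\<^sup>2 - (dist q r)\<^sup>2) / (2 * (dist p q * dist p r))"

lemma comparison_triangle_cos:
  assumes "comparison_triangle P Q R p q r"
  shows "((Q - P) \<bullet> (R - P)) / (norm (Q - P) * norm (R - P)) = comparison_cos p q r"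
proof -
  have "norm (Q - P) = dist p q" "norm (R - P) = dist p r"
    using assms by (simp_all add: comparison_triangle_def norm_minus_commute)
  then show ?thesis
    by (simp add: comparison_cos_def flip: comparison_triangle_inner[OF assms])
qed

lemma comparison_cos_in: "comparison_cos p q r \<in> {-1..1}"
proof -
  obtain P Q R where T: "comparison_triangle P Q R p q r"
    using comparison_triangle_exists by blast
  \<comment> \<open>This is Cauchy-Schwarz; for a side of length zero the quotient is 0, so the
    bound persists.\<close>
  have "\<bar>comparison_cos p q r\<bar> \<le> 1"
    unfolding comparison_triangle_cos[OF T, symmetric] abs_divide abs_mult abs_norm_cancel
    by (rule divide_le_eq_1[THEN iffD2])
      (use Cauchy_Schwarz_ineq2[of "Q - P" "R - P"] in \<open>auto simp: less_le\<close>)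
  then show ?thesis by (auto simp: abs_le_iff)
qed

text \<open>All comparison triangles for p, q, r have the same cosine at P, which makes the definite
  description in \<open>comparison_angle\<close> well defined.\<close>

lemma comparison_angle_eq_arccos:
  assumes "q \<noteq> p" "r \<noteq> p"
  shows "comparison_angle p q r = arccos (comparison_cos p q r)"
proof -
  obtain P Q R where T: "comparison_triangle P Q R p q r"
    using comparison_triangle_exists by blast
  have "(THE \<theta>. \<exists>P Q R. comparison_triangle P Q R p q r \<and> \<theta> = euclidean_angle P Q R)
      = arccos (comparison_cos p q r)"
    by (rule the_equality) (use T comparison_triangle_cos in \<open>force simp: euclidean_angle_def\<close>)+
  then show ?thesis using assms by (simp add: comparison_angle_def)
qed

lemma geodesics_fromD:
  assumes "\<gamma> \<in> geodesics_from p"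
  shows "\<gamma> 0 = p" "normalized_geodesic \<gamma>" "t \<in> {0..1} \<Longrightarrow> dist p (\<gamma> t) = t * dist p (\<gamma> 1)"
  using assms normalized_geodesic_dist[of \<gamma> 0 t] by (auto simp: geodesics_from_def mult.commute)

lemma geodesic_from_to_initial_segment:
  assumes "\<gamma> \<in> geodesics_from p" "s \<in> {0..1}"
  shows "geodesic_from_to (\<lambda>u\<in>{0..1}. \<gamma> (u * s)) p (\<gamma> s)"
  using geodesic_from_to_subsegment[OF geodesics_fromD(2)[OF assms(1)], of 0 s]
    geodesics_fromD(1)[OF assms(1)] assms(2) by simp

lemma geodesics_from_neq:
  assumes "\<gamma> \<in> geodesics_from p" "\<gamma> 1 \<noteq> p" "0 < t" "t \<le> 1"
  shows "\<gamma> t \<noteq> p"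
  using geodesics_fromD(3)[OF assms(1), of t] assms by auto

section \<open>Monotonicity of comparison angles and existence of the Alexandrov angle\<close>

lemma comparison_cos_antimono:
  fixes p :: "'a::cat0_space"
  assumes \<gamma>: "\<gamma> \<in> geodesics_from p" "\<gamma> 1 \<noteq> p" and \<delta>: "\<delta> \<in> geodesics_from p" "\<delta> 1 \<noteq> p"
    and s: "0 < s" "s \<le> s'" "s' \<le> 1" and t: "0 < t" "t \<le> t'" "t' \<le> 1"
  shows "comparison_cos p (\<gamma> s') (\<delta> t') \<le> comparison_cos p (\<gamma> s) (\<delta> t)"
proof -
  define \<sigma> \<tau> A B D
    where "\<sigma> = s / s'" "\<tau> = t / t'" "A = dist p (\<gamma> s')" "B = dist p (\<delta> t')" "D = dist (\<gamma> s') (\<delta> t')"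
  note defs = this
  have st: "0 < \<sigma>" "\<sigma> \<le> 1" "0 < \<tau>" "\<tau> \<le> 1" "\<sigma> * s' = s" "\<tau> * t' = t"
    using s t by (simp_all add: defs)
  have A: "A > 0" and B: "B > 0"
    using s t geodesics_from_neq[OF \<gamma>, of s'] geodesics_from_neq[OF \<delta>, of t'] by (simp_all add: defs)
  have "dist p (\<gamma> s) = s * dist p (\<gamma> 1)" "A = s' * dist p (\<gamma> 1)"
    "dist p (\<delta> t) = t * dist p (\<delta> 1)" "B = t' * dist p (\<delta> 1)"
    unfolding defs(3,4) using s t \<gamma>(1) \<delta>(1) by (auto intro!: geodesics_fromD(3))
  then have ds: "dist p (\<gamma> s) = \<sigma> * A" and dt: "dist p (\<delta> t) = \<tau> * B"
    unfolding st(5,6)[symmetric] by (simp_all only: mult.assoc)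
  \<comment> \<open>The inner points lie at parameters \<open>\<sigma>\<close> and
    \<open>\<tau>\<close> on the sides of the outer triangle, so the CAT(0) inequality applies
    inside that triangle.\<close>
  have "geodesic_from_to (\<lambda>u\<in>{0..1}. \<gamma> (u * s')) p (\<gamma> s')"
    "geodesic_from_to (\<lambda>u\<in>{0..1}. \<delta> (u * t')) p (\<delta> t')"
    using s t by (auto intro!: geodesic_from_to_initial_segment \<gamma>(1) \<delta>(1))
  from cat0_square_inequality[OF this, of \<sigma> \<tau>]
  have "(dist (\<gamma> s) (\<delta> t))\<^sup>2 \<le> \<sigma>\<^sup>2 * A\<^sup>2 + \<tau>\<^sup>2 * B\<^sup>2 - \<sigma> * \<tau> * (A\<^sup>2 + B\<^sup>2 - D\<^sup>2)"
    using st unfolding defs(3-5) by simp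
  then have *: "\<sigma> * \<tau> * (A\<^sup>2 + B\<^sup>2 - D\<^sup>2) \<le> (\<sigma> * A)\<^sup>2 + (\<tau> * B)\<^sup>2 - (dist (\<gamma> s) (\<delta> t))\<^sup>2"
    by (simp only: power_mult_distrib)
  have "comparison_cos p (\<gamma> s') (\<delta> t') = (A\<^sup>2 + B\<^sup>2 - D\<^sup>2) / (2 * (A * B))"
    by (simp only: comparison_cos_def defs(3-5))
  \<comment> \<open>Extending the fraction by \<open>\<sigma> * \<tau>\<close> turns its denominator
    into that of the inner triangle, leaving only numerators to compare.\<close>
  also have "\<dots> = ((\<sigma> * \<tau>) * (A\<^sup>2 + B\<^sup>2 - D\<^sup>2)) / ((\<sigma> * \<tau>) * (2 * (A * B)))"
    using st by (intro mult_divide_mult_cancel_left[symmetric]) simp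
  also have "\<dots> \<le> ((\<sigma> * A)\<^sup>2 + (\<tau> * B)\<^sup>2 - (dist (\<gamma> s) (\<delta> t))\<^sup>2) / ((\<sigma> * \<tau>) * (2 * (A * B)))"
    using st A B by (intro divide_right_mono[OF *]) simp
  also have "\<dots> = comparison_cos p (\<gamma> s) (\<delta> t)"
    unfolding comparison_cos_def ds dt by (simp add: mult_ac)
  finally show ?thesis .
qed

lemma eventually_pair_at_right_0:
  fixes P :: "real \<times> real \<Rightarrow> bool"
  assumes "0 < a" "0 < b" "\<And>s t. 0 < s \<Longrightarrow> s < a \<Longrightarrow> 0 < t \<Longrightarrow> t < b \<Longrightarrow> P (s, t)"
  shows "eventually P (at_right 0 \<times>\<^sub>F at_right 0)"
proof -
  have "\<forall>\<^sub>F s in at_right 0. s \<in> {0<..<a}" "\<forall>\<^sub>F t in at_right 0. t \<in> {0<..<b}"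
    using assms(1,2) by (auto intro: eventually_at_rightI)
  then have "\<forall>\<^sub>F x in at_right 0 \<times>\<^sub>F at_right 0. fst x \<in> {0<..<a} \<and> snd x \<in> {0<..<b}"
    by (rule eventually_prodI)
  then show ?thesis
    by (rule eventually_mono) (use assms(3) in auto)
qed

lemma pair_at_right_0_neq_bot: "at_right (0::real) \<times>\<^sub>F at_right (0::real) \<noteq> bot"
  by (simp add: prod_filter_eq_bot)

text \<open>The cosine increases as either parameter decreases and is bounded by 1, so it converges
  to its supremum over (0,1] x (0,1]. The index (1, 1) supplies the final inequality.\<close>

lemma comparison_cos_tendsto:
  fixes p :: "'a::cat0_space"
  assumes \<gamma>: "\<gamma> \<in> geodesics_from p" "\<gamma> 1 \<noteq> p" and \<delta>: "\<delta> \<in> geodesics_from p" "\<delta> 1 \<noteq> p"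
  obtains c where "c \<in> {-1..1}"
    "((\<lambda>(s, t). comparison_cos p (\<gamma> s) (\<delta> t)) \<longlongrightarrow> c) (at_right 0 \<times>\<^sub>F at_right 0)"
    "comparison_cos p (\<gamma> 1) (\<delta> 1) \<le> c"
proof
  let ?I = "{0<..1::real} \<times> {0<..1::real}" and ?C = "\<lambda>(s, t). comparison_cos p (\<gamma> s) (\<delta> t)"
  define c where "c = (SUP x\<in>?I. ?C x)"
  have C: "?C x \<in> {-1..1}" for x by (cases x) (simp only: prod.case comparison_cos_in)
  then have bdd: "bdd_above (?C ` ?I)" by (auto intro!: bdd_aboveI2[where M = 1])
  have ub: "?C x \<le> c" if "x \<in> ?I" for x
    unfolding c_def by (rule cSUP_upper[OF that bdd])
  have ne: "?I \<noteq> {}" by auto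
  show "comparison_cos p (\<gamma> 1) (\<delta> 1) \<le> c" using ub[of "(1, 1)"] by simp
  moreover have "c \<le> 1" unfolding c_def using C by (intro cSUP_least[OF ne]) auto
  ultimately show "c \<in> {-1..1}" using C[of "(1, 1)"] by auto
  show "(?C \<longlongrightarrow> c) (at_right 0 \<times>\<^sub>F at_right 0)"
  proof (rule order_tendstoI)
    fix a assume "a < c"
    then obtain s t where st: "s \<in> {0<..1}" "t \<in> {0<..1}" "a < ?C (s, t)"
      unfolding c_def less_cSUP_iff[OF ne bdd] by auto
    show "\<forall>\<^sub>F x in at_right 0 \<times>\<^sub>F at_right 0. a < ?C x"
    proof (rule eventually_pair_at_right_0[of s t])
      fix u v assume "0 < u" "u < s" "0 < v" "v < t"
      then have "?C (s, t) \<le> ?C (u, v)"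
        using st by (simp add: comparison_cos_antimono[OF \<gamma> \<delta>])
      then show "a < ?C (u, v)" using st(3) by linarith
    qed (use st in auto)
  next
    fix a assume "c < a"
    show "\<forall>\<^sub>F x in at_right 0 \<times>\<^sub>F at_right 0. ?C x < a"
    proof (rule eventually_pair_at_right_0[of 1 1])
      fix s t :: real assume "0 < s" "s < 1" "0 < t" "t < 1"
      then show "?C (s, t) < a" using ub[of "(s, t)"] \<open>c < a\<close> by simp
    qed simp_all
  qed
qed

text \<open>\<open>Lim\<close> is a definite description, so convergence has to be established
  before the angle can be used. Continuity of \<open>arccos\<close> on [-1,1] carries the limit of
  the cosines to the angles. The last claim says that the Alexandrov angle is at most the comparison
  angle.\<close>

lemma alexandrov_angle_props:
  fixes p :: "'a::cat0_space"
  assumes \<gamma>: "\<gamma> \<in> geodesics_from p" "\<gamma> 1 \<noteq> p" and \<delta>: "\<delta> \<in> geodesics_from p" "\<delta> 1 \<noteq> p"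
  shows alexandrov_angle_in: "alexandrov_angle p \<gamma> \<delta> \<in> {0..pi}"
    and comparison_cos_tendsto_cos_angle:
      "((\<lambda>(s, t). comparison_cos p (\<gamma> s) (\<delta> t)) \<longlongrightarrow> cos (alexandrov_angle p \<gamma> \<delta>))
        (at_right 0 \<times>\<^sub>F at_right 0)"
    and comparison_cos_le_cos_angle:
      "comparison_cos p (\<gamma> 1) (\<delta> 1) \<le> cos (alexandrov_angle p \<gamma> \<delta>)"
proof -
  let ?F = "at_right (0::real) \<times>\<^sub>F at_right (0::real)"
  let ?C = "\<lambda>(s, t). comparison_cos p (\<gamma> s) (\<delta> t)"
  obtain c where c: "c \<in> {-1..1}" "(?C \<longlongrightarrow> c) ?F" "comparison_cos p (\<gamma> 1) (\<delta> 1) \<le> c"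
    using comparison_cos_tendsto[OF assms] .
  have C: "?C x \<in> {-1..1}" for x by (cases x) (simp only: prod.case comparison_cos_in)
  have "((\<lambda>x. arccos (?C x)) \<longlongrightarrow> arccos c) ?F"
    by (rule continuous_on_tendsto_compose[OF continuous_on_arccos' c(2,1)])
      (simp only: C eventually_True)
  moreover have "\<forall>\<^sub>F x in ?F. arccos (?C x) = (\<lambda>(s, t). comparison_angle p (\<gamma> s) (\<delta> t)) x"
    by (rule eventually_pair_at_right_0[of 1 1])
      (auto simp: comparison_angle_eq_arccos geodesics_from_neq[OF \<gamma>] geodesics_from_neq[OF \<delta>])
  ultimately have "((\<lambda>(s, t). comparison_angle p (\<gamma> s) (\<delta> t)) \<longlongrightarrow> arccos c) ?F"
    by (rule Lim_transform_eventually)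
  then have eq: "alexandrov_angle p \<gamma> \<delta> = arccos c"
    unfolding alexandrov_angle_def by (rule tendsto_Lim[OF pair_at_right_0_neq_bot])
  then have cos: "cos (alexandrov_angle p \<gamma> \<delta>) = c" using c(1) by simp
  show "alexandrov_angle p \<gamma> \<delta> \<in> {0..pi}"
    using c(1) by (simp add: eq arccos_lbound arccos_ubound)
  show "(?C \<longlongrightarrow> cos (alexandrov_angle p \<gamma> \<delta>)) ?F"
    and "comparison_cos p (\<gamma> 1) (\<delta> 1) \<le> cos (alexandrov_angle p \<gamma> \<delta>)"
    using c(2,3) by (simp_all only: cos)
qed

lemma geodesics_from_zero:
  assumes "\<gamma> \<in> geodesics_from p" "\<gamma> 1 = p" "t \<in> {0..1}"
  shows "\<gamma> t = p"
  using geodesics_fromD(3)[OF assms(1,3)] assms(2) by simp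

text \<open>By the conventions for degenerate triangles the comparison angle is constant for
  parameters in (0,1). The value pi/2 keeps zero and nonzero geodesics in different
  directions.\<close>

lemma alexandrov_angle_zero:
  assumes \<gamma>: "\<gamma> \<in> geodesics_from p" and \<delta>: "\<delta> \<in> geodesics_from p"
    and "\<gamma> 1 = p \<or> \<delta> 1 = p"
  shows "alexandrov_angle p \<gamma> \<delta> = (if \<gamma> 1 = p \<and> \<delta> 1 = p then 0 else pi / 2)"
proof -
  let ?v = "if \<gamma> 1 = p \<and> \<delta> 1 = p then 0 else pi / 2"
  have *: "\<eta> t = p \<longleftrightarrow> \<eta> 1 = p" if "\<eta> \<in> geodesics_from p" "0 < t" "t < 1" for \<eta> t
    using geodesics_from_zero[OF that(1), of t] geodesics_from_neq[OF that(1), of t] that by auto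
  have "\<forall>\<^sub>F x in at_right 0 \<times>\<^sub>F at_right 0. ?v = (\<lambda>(s, t). comparison_angle p (\<gamma> s) (\<delta> t)) x"
  proof (rule eventually_pair_at_right_0[of 1 1])
    fix s t :: real assume "0 < s" "s < 1" "0 < t" "t < 1"
    then show "?v = (\<lambda>(s, t). comparison_angle p (\<gamma> s) (\<delta> t)) (s, t)"
      using assms(3) *[OF \<gamma>, of s] *[OF \<delta>, of t] by (auto simp: comparison_angle_def)
  qed simp_all
  then have "((\<lambda>(s, t). comparison_angle p (\<gamma> s) (\<delta> t)) \<longlongrightarrow> ?v) (at_right 0 \<times>\<^sub>F at_right 0)"
    by (rule Lim_transform_eventually[OF tendsto_const])
  then show ?thesis
    unfolding alexandrov_angle_def by (rule tendsto_Lim[OF pair_at_right_0_neq_bot])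
qed

section \<open>Chord quotients and invariance of the angle\<close>

abbreviation chord_quotient :: "(real \<Rightarrow> 'a::metric_space) \<Rightarrow> (real \<Rightarrow> 'a) \<Rightarrow> real \<Rightarrow> real" where
  "chord_quotient \<gamma> \<delta> s \<equiv>
     dist (\<gamma> (s / dist (\<gamma> 0) (\<gamma> 1))) (\<delta> (s / dist (\<delta> 0) (\<delta> 1))) / s"

text \<open>Dividing the parameter by the speed puts both points at distance s from p. In this
  isosceles triangle the law of cosines reads \<open>(d / s)\<^sup>2 = 2 - 2 * cos\<close>, with d
  the chord.\<close>

lemma chord_quotient_tendsto:
  fixes p :: "'a::cat0_space"
  assumes \<gamma>: "\<gamma> \<in> geodesics_from p" "\<gamma> 1 \<noteq> p" and \<delta>: "\<delta> \<in> geodesics_from p" "\<delta> 1 \<noteq> p"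
  shows "(chord_quotient \<gamma> \<delta> \<longlongrightarrow> sqrt (2 - 2 * cos (alexandrov_angle p \<gamma> \<delta>))) (at_right 0)"
proof -
  define a b where ab: "a = dist p (\<gamma> 1)" "b = dist p (\<delta> 1)"
  have p: "a > 0" "b > 0" using \<gamma>(2) \<delta>(2) by (simp_all add: ab)
  \<comment> \<open>Both rescaled parameters tend to 0 from the right, so the two-parameter limit
    may be evaluated along (s/a, s/b).\<close>
  have scale: "filterlim (\<lambda>s. s / k) (at_right 0) (at_right 0)" if "k > 0" for k :: real
    unfolding filterlim_at
  proof
    show "\<forall>\<^sub>F s in at_right 0. s / k \<in> {0<..} \<and> s / k \<noteq> 0"
      using that by (intro eventually_at_rightI[of 0 1]) auto
    have "((\<lambda>s. s / k) \<longlongrightarrow> 0 / k) (at_right 0)" using that by (intro tendsto_intros) auto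
    then show "((\<lambda>s. s / k) \<longlongrightarrow> 0) (at_right 0)" by simp
  qed
  let ?C = "\<lambda>(s, t). comparison_cos p (\<gamma> s) (\<delta> t)"
  have "((\<lambda>s. ?C (s / a, s / b)) \<longlongrightarrow> cos (alexandrov_angle p \<gamma> \<delta>)) (at_right 0)"
    by (rule filterlim_compose[OF comparison_cos_tendsto_cos_angle[OF assms]
          filterlim_Pair[OF scale[OF p(1)] scale[OF p(2)]]])
  then have "((\<lambda>s. sqrt (2 - 2 * ?C (s / a, s / b)))
      \<longlongrightarrow> sqrt (2 - 2 * cos (alexandrov_angle p \<gamma> \<delta>))) (at_right 0)"
    by (intro tendsto_intros)
  moreover have "\<forall>\<^sub>F s in at_right 0. sqrt (2 - 2 * ?C (s / a, s / b)) = chord_quotient \<gamma> \<delta> s"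
  proof (rule eventually_at_rightI[of 0 "min a b"])
    fix s assume "s \<in> {0<..<min a b}"
    then have s: "0 < s" "s / a \<in> {0..1}" "s / b \<in> {0..1}" using p by auto
    have d: "dist p (\<gamma> (s / a)) = s" "dist p (\<delta> (s / b)) = s"
      using geodesics_fromD(3)[OF \<gamma>(1) s(2)] geodesics_fromD(3)[OF \<delta>(1) s(3)] p
      by (simp_all flip: ab)
    have "2 - 2 * ?C (s / a, s / b) = (dist (\<gamma> (s / a)) (\<delta> (s / b)) / s)\<^sup>2"
      using s(1) by (simp add: comparison_cos_def d power2_eq_square field_simps)
    then have "sqrt (2 - 2 * ?C (s / a, s / b)) = dist (\<gamma> (s / a)) (\<delta> (s / b)) / s"
      using s(1) by simp
    then show "sqrt (2 - 2 * ?C (s / a, s / b)) = chord_quotient \<gamma> \<delta> s"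
      by (simp only: ab geodesics_fromD(1)[OF \<gamma>(1)] geodesics_fromD(1)[OF \<delta>(1)])
  qed (use p in auto)
  ultimately show ?thesis by (rule Lim_transform_eventually)
qed

text \<open>
  On unit-speed parametrizations the angle is a function of the limiting chord quotient. Invariance
  of the angle under the direction relation thereby reduces to the triangle inequality of the
  metric, without the triangle inequality for angles.
\<close>

lemma alexandrov_angle_eqI:
  fixes p :: "'a::cat0_space"
  assumes "\<gamma> \<in> geodesics_from p" "\<gamma> 1 \<noteq> p" "\<delta> \<in> geodesics_from p" "\<delta> 1 \<noteq> p"
    and "(chord_quotient \<gamma> \<delta> \<longlongrightarrow> sqrt (2 - 2 * cos \<theta>)) (at_right 0)" "\<theta> \<in> {0..pi}"
  shows "alexandrov_angle p \<gamma> \<delta> = \<theta>"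
proof -
  have "sqrt (2 - 2 * cos (alexandrov_angle p \<gamma> \<delta>)) = sqrt (2 - 2 * cos \<theta>)"
    by (rule tendsto_unique[OF _ chord_quotient_tendsto[OF assms(1-4)] assms(5)]) simp
  then have "cos (alexandrov_angle p \<gamma> \<delta>) = cos \<theta>" by simp
  then show ?thesis
    using alexandrov_angle_in[OF assms(1-4)] assms(6) by (auto intro: cos_inj_pi)
qed

lemma alexandrov_angle_commute:
  fixes p :: "'a::cat0_space"
  assumes "\<gamma> \<in> geodesics_from p" "\<delta> \<in> geodesics_from p"
  shows "alexandrov_angle p \<delta> \<gamma> = alexandrov_angle p \<gamma> \<delta>"
proof (cases "\<gamma> 1 = p \<or> \<delta> 1 = p")
  case True
  then show ?thesis
    using alexandrov_angle_zero[of \<gamma> p \<delta>] alexandrov_angle_zero[of \<delta> p \<gamma>] assms by auto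
next
  case False
  have "chord_quotient \<gamma> \<delta> = chord_quotient \<delta> \<gamma>" by (simp add: dist_commute)
  then show ?thesis
    using False assms chord_quotient_tendsto[of \<gamma> p \<delta>] alexandrov_angle_in[of \<gamma> p \<delta>]
    by (intro alexandrov_angle_eqI) simp_all
qed

text \<open>Angle zero makes the chord quotient of \<open>\<gamma>\<close> and \<open>\<eta>\<close>
  tend to 0. By the reverse triangle inequality it dominates the difference of their chord quotients
  with \<open>\<delta>\<close>, so these have the same limit.\<close>

lemma alexandrov_angle_cong:
  fixes p :: "'a::cat0_space"
  assumes \<gamma>: "\<gamma> \<in> geodesics_from p" and \<eta>: "\<eta> \<in> geodesics_from p" and \<delta>: "\<delta> \<in> geodesics_from p"
    and eq: "alexandrov_angle p \<gamma> \<eta> = 0"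
  shows "alexandrov_angle p \<eta> \<delta> = alexandrov_angle p \<gamma> \<delta>"
proof (cases "\<gamma> 1 = p \<or> \<eta> 1 = p \<or> \<delta> 1 = p")
  \<comment> \<open>A zero and a nonzero geodesic form the angle pi/2, so \<open>eq\<close> makes
    \<open>\<gamma>\<close> and \<open>\<eta>\<close> both zero or both nonzero; the formula for
    degenerate angles settles each case.\<close>
  case True
  then show ?thesis
    using alexandrov_angle_zero[OF \<gamma> \<eta>] alexandrov_angle_zero[OF \<gamma> \<delta>]
      alexandrov_angle_zero[OF \<eta> \<delta>] eq pi_gt_zero by (auto split: if_splits)
next
  case False
  let ?L = "sqrt (2 - 2 * cos (alexandrov_angle p \<gamma> \<delta>))"
  have lim0: "(chord_quotient \<gamma> \<eta> \<longlongrightarrow> 0) (at_right 0)"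
    using chord_quotient_tendsto[of \<gamma> p \<eta>] \<gamma> \<eta> False eq by simp
  have "((\<lambda>s. chord_quotient \<eta> \<delta> s - chord_quotient \<gamma> \<delta> s) \<longlongrightarrow> 0) (at_right 0)"
  proof (rule Lim_null_comparison[OF eventually_at_rightI lim0])
    fix s :: real assume "s \<in> {0<..<1}"
    have "\<bar>dist x z - dist y z\<bar> \<le> dist y x" for x y z :: 'a
      using dist_triangle[of x z y] dist_triangle[of y z x] by (simp add: dist_commute)
    then show "norm (chord_quotient \<eta> \<delta> s - chord_quotient \<gamma> \<delta> s) \<le> chord_quotient \<gamma> \<eta> s"
      using \<open>s \<in> {0<..<1}\<close> by (simp add: abs_divide divide_right_mono flip: diff_divide_distrib)
  qed simp
  moreover have "(chord_quotient \<gamma> \<delta> \<longlongrightarrow> ?L) (at_right 0)"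
    using False by (intro chord_quotient_tendsto \<gamma> \<delta>) auto
  ultimately have "((\<lambda>s. (chord_quotient \<eta> \<delta> s - chord_quotient \<gamma> \<delta> s) + chord_quotient \<gamma> \<delta> s)
      \<longlongrightarrow> 0 + ?L) (at_right 0)"
    by (rule tendsto_add)
  then have "(chord_quotient \<eta> \<delta> \<longlongrightarrow> ?L) (at_right 0)" by simp
  then show ?thesis
    using False alexandrov_angle_in[OF \<gamma> _ \<delta>] by (intro alexandrov_angle_eqI \<eta> \<delta>) auto
qed

text \<open>After unit-speed reparametrization a geodesic and its initial segment pass through the
  same points, so their chord quotient vanishes near 0.\<close>

lemma alexandrov_angle_initial_segment:
  fixes p :: "'a::cat0_space"
  assumes \<gamma>: "\<gamma> \<in> geodesics_from p" and k: "0 < k" "k \<le> 1"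
  shows "alexandrov_angle p \<gamma> (\<lambda>u\<in>{0..1}. \<gamma> (u * k)) = 0"
proof -
  let ?\<eta> = "\<lambda>u\<in>{0..1}. \<gamma> (u * k)"
  have \<eta>: "?\<eta> \<in> geodesics_from p"
    using geodesic_from_to_initial_segment[OF \<gamma>, of k] k
    by (simp add: geodesics_from_def geodesic_from_to_def)
  show ?thesis
  proof (cases "\<gamma> 1 = p")
    case True
    then have "?\<eta> 1 = p" using geodesics_from_zero[OF \<gamma>, of k] k by simp
    then show ?thesis using alexandrov_angle_zero[OF \<gamma> \<eta>] True by simp
  next
    case False
    then have "?\<eta> 1 \<noteq> p" using geodesics_from_neq[OF \<gamma>, of k] k by simp
    define a where "a = dist p (\<gamma> 1)"
    have a: "a > 0" using False by (simp add: a_def)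
    have 0: "\<gamma> 0 = p" "dist p (\<gamma> k) = k * a"
      using geodesics_fromD(1)[OF \<gamma>] geodesics_fromD(3)[OF \<gamma>, of k] k by (simp_all add: a_def)
    have "(chord_quotient \<gamma> ?\<eta> \<longlongrightarrow> 0) (at_right 0)"
    proof (rule Lim_transform_eventually[OF tendsto_const eventually_at_rightI])
      \<comment> \<open>The bound \<open>k * a\<close> is the length of the segment: below it the
        argument of the restricted map stays in [0,1], and both points are
        \<open>\<gamma> (s / a)\<close>.\<close>
      fix s assume "s \<in> {0<..<k * a}"
      then have "0 \<le> s" "s / (k * a) \<le> 1" "0 \<le> s / (k * a)" "s / (k * a) * k = s / a"
        using a k by (simp_all add: field_simps)
      then show "0 = chord_quotient \<gamma> ?\<eta> s" using 0 by (simp flip: a_def)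
    qed (use a k in simp)
    then show ?thesis
      using False \<gamma> \<eta> \<open>?\<eta> 1 \<noteq> p\<close> by (intro alexandrov_angle_eqI) simp_all
  qed
qed

lemma alexandrov_angle_self:
  fixes p :: "'a::cat0_space"
  assumes "\<gamma> \<in> geodesics_from p"
  shows "alexandrov_angle p \<gamma> \<gamma> = 0"
proof -
  have "(\<lambda>u\<in>{0..1}. \<gamma> (u * 1)) = \<gamma>"
    using geodesics_fromD(2)[OF assms] by (simp add: normalized_geodesic_def extensional_restrict)
  then show ?thesis using alexandrov_angle_initial_segment[OF assms, of 1] by simp
qed

section \<open>Tangent spaces\<close>

lemma zeta_geodesics_from:
  assumes "\<gamma> \<in> geodesics_from p"
  shows "zeta \<gamma> = (if \<gamma> 1 = p then 0 else 1)"
  using geodesics_fromD(1)[OF assms] by (auto simp: zeta_def)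

section \<open>Directions and the functions induced on them\<close>

lemma direction_class_iff:
  "\<eta> \<in> direction_rel p `` {\<gamma>} \<longleftrightarrow>
     \<gamma> \<in> geodesics_from p \<and> \<eta> \<in> geodesics_from p \<and> alexandrov_angle p \<gamma> \<eta> = 0"
  by (auto simp: direction_rel_def)

lemma direction_class_self:
  fixes p :: "'a::cat0_space"
  assumes "\<gamma> \<in> geodesics_from p"
  shows "\<gamma> \<in> direction_rel p `` {\<gamma>}"
  unfolding direction_class_iff using assms by (simp add: alexandrov_angle_self)

lemma equiv_direction_rel:
  fixes p :: "'a::cat0_space"
  shows "equiv (geodesics_from p) (direction_rel p)"
proof (rule equivI)
  show "direction_rel p \<subseteq> geodesics_from p \<times> geodesics_from p"
    by (auto simp: direction_rel_def)
  show "refl_on (geodesics_from p) (direction_rel p)"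
    by (auto simp: refl_on_def direction_rel_def alexandrov_angle_self)
  show "sym (direction_rel p)"
    by (auto simp: sym_def direction_rel_def alexandrov_angle_commute)
  show "trans (direction_rel p)"
    by (auto simp: trans_def direction_rel_def dest: alexandrov_angle_cong)
qed

lemma direction_class_in_directions:
  assumes "\<gamma> \<in> geodesics_from p"
  shows "direction_rel p `` {\<gamma>} \<in> directions p"
  using assms by (simp add: directions_def quotientI)

lemma the_elem_UN_singleton:
  assumes "a \<in> S" "\<And>x. x \<in> S \<Longrightarrow> f x = v"
  shows "the_elem (\<Union>x\<in>S. {f x}) = v"
proof -
  have "(\<Union>x\<in>S. {f x}) = {v}" using assms by auto
  then show ?thesis by simp
qed

text \<open>A class cannot mix zero and nonzero geodesics, since their angle is pi/2; hence
  \<open>zeta\<close> is constant on it.\<close>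

lemma direction_zeta_class:
  fixes p :: "'a::cat0_space"
  assumes "\<gamma> \<in> geodesics_from p"
  shows "direction_zeta (direction_rel p `` {\<gamma>}) = zeta \<gamma>"
  unfolding direction_zeta_def
proof (rule the_elem_UN_singleton)
  show "\<gamma> \<in> direction_rel p `` {\<gamma>}"
    by (rule direction_class_self[OF assms])
  fix \<eta> assume "\<eta> \<in> direction_rel p `` {\<gamma>}"
  then have \<eta>: "\<eta> \<in> geodesics_from p" "alexandrov_angle p \<gamma> \<eta> = 0"
    unfolding direction_class_iff by simp_all
  then show "zeta \<eta> = zeta \<gamma>"
    using alexandrov_angle_zero[OF assms \<eta>(1)] pi_gt_zero
    by (auto simp: zeta_geodesics_from[OF assms] zeta_geodesics_from[OF \<eta>(1)] split: if_splits)
qed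

text \<open>Independence of representatives: \<open>alexandrov_angle_cong\<close> changes one
  argument, and symmetry transfers this to the other.\<close>

lemma direction_angle_class:
  fixes p :: "'a::cat0_space"
  assumes "\<gamma> \<in> geodesics_from p" "\<delta> \<in> geodesics_from p"
  shows "direction_angle p (direction_rel p `` {\<gamma>}) (direction_rel p `` {\<delta>})
    = alexandrov_angle p \<gamma> \<delta>"
proof -
  let ?c = "direction_rel p `` {\<gamma>}" and ?d = "direction_rel p `` {\<delta>}"
  have eq: "alexandrov_angle p \<gamma>' \<delta>' = alexandrov_angle p \<gamma> \<delta>" if "\<gamma>' \<in> ?c" "\<delta>' \<in> ?d" for \<gamma>' \<delta>'
  proof -
    note that [unfolded direction_class_iff]
    then show ?thesis
      using alexandrov_angle_cong[of \<gamma> p \<gamma>' \<delta>'] alexandrov_angle_cong[of \<delta> p \<delta>' \<gamma>]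
        alexandrov_angle_commute[of \<gamma> p \<delta>] alexandrov_angle_commute[of \<gamma> p \<delta>'] by simp
  qed
  have mem: "\<gamma> \<in> ?c" "\<delta> \<in> ?d"
    by (rule direction_class_self; fact)+
  have "(\<Union>\<gamma>'\<in>?c. \<Union>\<delta>'\<in>?d. {alexandrov_angle p \<gamma>' \<delta>'}) = {alexandrov_angle p \<gamma> \<delta>}"
  proof (intro equalityI subsetI)
    fix x assume "x \<in> {alexandrov_angle p \<gamma> \<delta>}"
    then show "x \<in> (\<Union>\<gamma>'\<in>?c. \<Union>\<delta>'\<in>?d. {alexandrov_angle p \<gamma>' \<delta>'})"
      using mem by blast
  next
    fix x assume "x \<in> (\<Union>\<gamma>'\<in>?c. \<Union>\<delta>'\<in>?d. {alexandrov_angle p \<gamma>' \<delta>'})"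
    then show "x \<in> {alexandrov_angle p \<gamma> \<delta>}" using eq by blast
  qed
  then show ?thesis by (simp add: direction_angle_def)
qed

section \<open>Tangent vectors and their inner product\<close>

lemma tangent_cong:
  fixes p :: "'a::cat0_space"
  assumes "\<gamma> \<in> geodesics_from p" "\<eta> \<in> geodesics_from p" "alexandrov_angle p \<gamma> \<eta> = 0"
  shows "tangent p t \<gamma> = tangent p t \<eta>"
proof -
  have "direction_rel p `` {\<gamma>} = direction_rel p `` {\<eta>}"
    using assms by (intro equiv_class_eq[OF equiv_direction_rel]) (simp add: direction_rel_def)
  then show ?thesis by (simp add: tangent_def)
qed

text \<open>A tangent vector determines the product of scalar and \<open>zeta\<close>, but its
  direction only when that product is nonzero. This suffices for the inner product, which contains
  the product as a factor.\<close>

lemma tangent_memD: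
  fixes p :: "'a::cat0_space"
  assumes "\<gamma> \<in> geodesics_from p" "(u, c) \<in> tangent p t \<gamma>"
  shows "u * direction_zeta c = t * zeta \<gamma>"
    and "u * direction_zeta c \<noteq> 0 \<Longrightarrow> c = direction_rel p `` {\<gamma>}"
  using assms by (auto simp: tangent_def tangent_rel_def direction_zeta_class)

lemma tangent_mem:
  fixes p :: "'a::cat0_space"
  assumes "\<gamma> \<in> geodesics_from p" "0 \<le> t"
  shows "(t, direction_rel p `` {\<gamma>}) \<in> tangent p t \<gamma>"
  using assms
  by (auto simp: tangent_def tangent_rel_def direction_class_in_directions direction_zeta_class
      zeta_def)

lemma tangent_inner_tangent:
  fixes p :: "'a::cat0_space"
  assumes \<gamma>: "\<gamma> \<in> geodesics_from p" "0 \<le> t" and \<delta>: "\<delta> \<in> geodesics_from p" "0 \<le> s"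
  shows "tangent_inner p (tangent p t \<gamma>) (tangent p s \<delta>)
    = t * s * zeta \<gamma> * zeta \<delta> * cos (alexandrov_angle p \<gamma> \<delta>)" (is "_ = ?v")
proof -
  let ?f = "\<lambda>u c v d. u * v * direction_zeta c * direction_zeta d * cos (direction_angle p c d)"
  have val: "?f u c v d = ?v" if "(u, c) \<in> tangent p t \<gamma>" "(v, d) \<in> tangent p s \<delta>" for u c v d
  proof -
    note m = tangent_memD[OF \<gamma>(1) that(1)] tangent_memD[OF \<delta>(1) that(2)]
    have "?f u c v d = (u * direction_zeta c) * (v * direction_zeta d) * cos (direction_angle p c d)"
      by (simp add: mult_ac)
    also have "\<dots> = (t * zeta \<gamma>) * (s * zeta \<delta>) * cos (alexandrov_angle p \<gamma> \<delta>)"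
    \<comment> \<open>If a factor vanishes, the direction may be arbitrary but both sides are zero;
      otherwise both directions are determined.\<close>
    proof (cases "u * direction_zeta c = 0 \<or> v * direction_zeta d = 0")
      case True
      then show ?thesis unfolding m(1,3)[symmetric] by auto
    next
      case False
      then show ?thesis using m by (simp add: direction_angle_class[OF \<gamma>(1) \<delta>(1)])
    qed
    finally show ?thesis by (simp add: mult_ac)
  qed
  have "(\<Union>(u, c)\<in>tangent p t \<gamma>. \<Union>(v, d)\<in>tangent p s \<delta>. {?f u c v d}) = {?v}"
  proof (intro equalityI subsetI)
    fix x assume "x \<in> {?v}"
    moreover have "?f t (direction_rel p `` {\<gamma>}) s (direction_rel p `` {\<delta>}) = ?v"
      by (rule val[OF tangent_mem[OF \<gamma>] tangent_mem[OF \<delta>]])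
    ultimately show "x \<in> (\<Union>(u, c)\<in>tangent p t \<gamma>. \<Union>(v, d)\<in>tangent p s \<delta>. {?f u c v d})"
      by (intro UN_I[OF tangent_mem[OF \<gamma>]]) (auto intro!: bexI[OF _ tangent_mem[OF \<delta>]])
  next
    fix x assume "x \<in> (\<Union>(u, c)\<in>tangent p t \<gamma>. \<Union>(v, d)\<in>tangent p s \<delta>. {?f u c v d})"
    then obtain u c v d
      where "(u, c) \<in> tangent p t \<gamma>" "(v, d) \<in> tangent p s \<delta>" "x = ?f u c v d" by blast
    then show "x \<in> {?v}" using val by simp
  qed
  then show ?thesis by (simp add: tangent_inner_def)
qed

text \<open>This rearranges the fact that the Alexandrov angle is at most the comparison angle. For
  x = z the cosine term has coefficient zero.\<close>

lemma law_of_cosines_ge: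
  fixes z :: "'a::cat0_space"
  assumes "z \<noteq> w"
  shows "(dist z x)\<^sup>2 + (dist z w)\<^sup>2
      - 2 * dist z w * (dist z x * cos (alexandrov_angle z (geodesic z x) (geodesic z w)))
    \<le> (dist x w)\<^sup>2"
proof (cases "x = z")
  case False
  let ?\<alpha> = "alexandrov_angle z (geodesic z x) (geodesic z w)"
  have "comparison_cos z (geodesic z x 1) (geodesic z w 1) \<le> cos ?\<alpha>"
    using assms False by (intro comparison_cos_le_cos_angle geodesic_in_geodesics_from) simp_all
  then have "(dist z x)\<^sup>2 + (dist z w)\<^sup>2 - (dist x w)\<^sup>2 \<le> cos ?\<alpha> * (2 * (dist z x * dist z w))"
    using assms False by (simp add: comparison_cos_def pos_divide_le_eq)
  then show ?thesis by (simp add: mult_ac)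
qed simp

section \<open>Resolvents\<close>

lemma resolvent_dist_le:
  assumes mono: "monotone_field A" and r: "r > 0"
    and z: "z \<in> resolvent A r x" and w: "w \<in> resolvent A r y"
  shows "dist z w \<le> dist x y"
proof (cases "z = w")
  case False
  define \<alpha> \<beta> where "\<alpha> = alexandrov_angle z (geodesic z x) (geodesic z w)"
    and "\<beta> = alexandrov_angle w (geodesic w y) (geodesic w z)"
  \<comment> \<open>The factor \<open>zeta\<close> is absorbed because it vanishes exactly when the
    distance does.\<close>
  have zeta: "dist p q * zeta (geodesic p q) = dist p q" for p q :: 'a
    by (simp add: zeta_def)
  have inner: "tangent_inner p (tangent p (inverse r * dist p q) (geodesic p q)) (tangent p 1 (geodesic p p'))
      = inverse r * (dist p q * cos (alexandrov_angle p (geodesic p q) (geodesic p p')))"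
    if "p \<noteq> p'" for p q p' :: 'a
  proof -
    have "zeta (geodesic p p') = 1" using that by (simp add: zeta_def)
    then show ?thesis
      using r by (simp add: tangent_inner_tangent geodesic_in_geodesics_from mult.assoc zeta
          flip: mult.assoc[of "dist p q"])
  qed
  have "inverse r * (dist z x * cos \<alpha>) \<le> - (inverse r * (dist w y * cos \<beta>))"
    using mono z w inner[of z w x] inner[of w z y] False
    unfolding monotone_field_def resolvent_def \<alpha>_def \<beta>_def by fastforce
  then have "inverse r * (dist z x * cos \<alpha> + dist w y * cos \<beta>) \<le> 0"
    by (simp add: distrib_left)
  then have "dist z x * cos \<alpha> + dist w y * cos \<beta> \<le> 0"
    using r by (simp add: mult_le_0_iff)
  \<comment> \<open>Monotonicity pairs with unit multiples of the geodesics between z and w; the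
    factor \<open>2 * dist z w\<close> produces the cosine terms of the two laws of cosines.\<close>
  then have "2 * dist z w * (dist z x * cos \<alpha> + dist w y * cos \<beta>) \<le> 0"
    by (simp add: mult_nonneg_nonpos)
  then have le: "2 * dist z w * (dist z x * cos \<alpha>) + 2 * dist z w * (dist w y * cos \<beta>) \<le> 0"
    by (simp only: distrib_left)
  have "(dist z x)\<^sup>2 + (dist z w)\<^sup>2 - 2 * dist z w * (dist z x * cos \<alpha>) \<le> (dist x w)\<^sup>2"
    unfolding \<alpha>_def by (rule law_of_cosines_ge[OF False])
  moreover have "(dist w y)\<^sup>2 + (dist z w)\<^sup>2 - 2 * dist z w * (dist w y * cos \<beta>) \<le> (dist z y)\<^sup>2"
    using law_of_cosines_ge[of w z y] False unfolding \<beta>_def by (simp add: dist_commute)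
  \<comment> \<open>The crossed distances x-w and z-y are the diagonals. Against the sum of the two
    laws of cosines, everything cancels except one \<open>(dist z w)\<^sup>2\<close> and
    \<open>(dist x y)\<^sup>2\<close>.\<close>
  moreover have "(dist x w)\<^sup>2 + (dist z y)\<^sup>2
      \<le> (dist z x)\<^sup>2 + (dist z w)\<^sup>2 + (dist w y)\<^sup>2 + (dist x y)\<^sup>2"
    using quadrilateral_inequality[of x w z y] by (simp add: dist_commute)
  ultimately have "(dist z w)\<^sup>2 \<le> (dist x y)\<^sup>2" using le by linarith
  then show ?thesis by (rule power2_le_imp_le) simp
qed simp

text \<open>Moving x to parameter m/r scales its distance to z by m/r, which offsets the change from
  1/r to 1/m. The direction at z is unchanged, so the tangent vector required to lie in
  \<open>A z\<close> is the same.\<close>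

lemma resolvent_geodesic:
  assumes m: "0 < m" "m \<le> r" and z: "z \<in> resolvent A r x"
  shows "z \<in> resolvent A m (geodesic z x (m / r))"
proof -
  let ?k = "m / r" and ?\<gamma> = "geodesic z x"
  have k: "0 < ?k" "?k \<le> 1" using m by simp_all
  have sub: "geodesic z (?\<gamma> ?k) = (\<lambda>u\<in>{0..1}. ?\<gamma> (u * ?k))"
    using k by (intro geodesic_eqI geodesic_from_to_initial_segment geodesic_in_geodesics_from) simp
  have "inverse m * dist z (?\<gamma> ?k) = inverse r * dist z x"
    using dist_geodesic[of 0 ?k z x] k m by (simp add: field_simps)
  moreover have "tangent z t (geodesic z (?\<gamma> ?k)) = tangent z t ?\<gamma>" for t
    using alexandrov_angle_initial_segment[OF geodesic_in_geodesics_from[of z x] k]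
    unfolding sub[symmetric]
    by (intro tangent_cong[symmetric] geodesic_in_geodesics_from)
  ultimately show ?thesis using z by (simp add: resolvent_def)
qed

lemma zero_tangent_resolvent:
  "x \<in> resolvent A r x \<longleftrightarrow> zero_tangent x \<in> A x"
  by (simp add: resolvent_def zero_tangent_def)

theorem proposition4p3:
  fixes A :: "'a::{complete_space, cat0_space} \<Rightarrow> 'a tangent set"
    and r :: real
  assumes "vector_field A"
    and "monotone_field A"
    and "surjectivity_condition A"
    and "r > 0"
  shows "(\<forall>x. \<exists>z. resolvent A r x = {z}) \<and>
    nonexpansive (resolvent_map A r) \<and>
    Fix (resolvent_map A r) = zeros A \<and>
    (\<forall>m. 0 < m \<and> m \<le> r \<longrightarrow>
       (\<forall>x. resolvent_map A r x =
              resolvent_map A m (geodesic (resolvent_map A r x) x (m / r)))) \<and>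
    firmly_nonexpansive (resolvent_map A r)"
proof -
  let ?J = "resolvent_map A"
  have single: "resolvent A l x = {?J l x}" if "l > 0" for l x
  proof -
    \<comment> \<open>The surjectivity condition with t = 1/l is nonemptiness of the
      resolvent.\<close>
    have "inverse l > 0" using that by simp
    then obtain z where z: "z \<in> resolvent A l x"
      using assms(3)
      unfolding surjectivity_condition_def resolvent_def by blast
    have "w = z" if "w \<in> resolvent A l x" for w
      using resolvent_dist_le[OF assms(2) \<open>l > 0\<close> that z] by simp
    then have "resolvent A l x = {z}" using z by blast
    then show ?thesis by (simp add: resolvent_map_def)
  qed
  have mem: "?J l x \<in> resolvent A l x" if "l > 0" for l x
    using single[OF that, of x] by simp
  have nonexp: "dist (?J l x) (?J l y) \<le> dist x y" if "l > 0" for l x y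
    by (rule resolvent_dist_le[OF assms(2) that mem[OF that] mem[OF that]])
  have shift: "?J r x = ?J m (geodesic (?J r x) x (m / r))" if "0 < m" "m \<le> r" for m x
    using resolvent_geodesic[OF that mem[OF assms(4), of x]] single[OF that(1)] by simp
  have "Fix (?J r) = zeros A"
  proof -
    have "x \<in> resolvent A r x \<longleftrightarrow> x = ?J r x" for x
      by (simp only: single[OF assms(4)] singleton_iff)
    then have "?J r x = x \<longleftrightarrow> zero_tangent x \<in> A x" for x
      by (metis zero_tangent_resolvent)
    then show ?thesis by (simp add: Fix_def zeros_def)
  qed
  moreover have "firmly_nonexpansive (?J r)"
    unfolding firmly_nonexpansive_def
  proof (intro allI monotone_onI)
    fix x y and s t :: real
    assume s: "s \<in> {0..1}" and t: "t \<in> {0..1}" and "s \<le> t"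
    let ?f = "\<lambda>t. dist (geodesic x (?J r x) t) (geodesic y (?J r y) t)"
    have end_le: "?f 1 \<le> ?f s"
    proof (cases "s = 1")
      case False
      \<comment> \<open>Chosen so that ?m / r = 1 - s: seen from \<open>?J r v\<close>, the point at
        parameter s lies at parameter 1 - s, so \<open>shift\<close> gives \<open>?J r v\<close> as
        the value of \<open>?J ?m\<close> there. Positivity of ?m requires s < 1.\<close>
      let ?m = "(1 - s) * r"
      have m: "0 < ?m" "?m \<le> r" "?m / r = 1 - s" using s False assms(4) by simp_all
      have "?J r v = ?J ?m (geodesic v (?J r v) s)" for v
        using shift[OF m(1,2), of v] m(3) geodesic_reverse[OF s, of v "?J r v"] by simp
      then show ?thesis using nonexp[OF m(1)] by (metis geodesic_1)
    qed simp
    \<comment> \<open>The relative position of t in [s,1]. For s = 1 also t = 1, and the value 0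
      avoids a zero denominator.\<close>
    define u where "u = (if s = 1 then 0 else (t - s) / (1 - s))"
    have u: "u \<in> {0..1}" "(1 - u) * s + u * 1 = t"
      using s t \<open>s \<le> t\<close> by (auto simp: u_def field_simps)
    have "geodesic v (?J r v) t = geodesic (geodesic v (?J r v) s) (?J r v) u" for v
      using geodesic_subsegment[of s 1 u v "?J r v"] s u by simp
    \<comment> \<open>Convexity on [s,1] bounds the value at t by an average of the end values, and
      the right end value is at most the left one.\<close>
    then have "?f t \<le> (1 - u) * ?f s + u * ?f 1"
      using dist_geodesic_convex[OF u(1)] by simp
    also have "\<dots> \<le> (1 - u) * ?f s + u * ?f s"
      using u(1) by (intro add_left_mono mult_left_mono end_le) simp
    finally show "?f t \<le> ?f s" by (simp add: algebra_simps)
  qed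
  moreover have "nonexpansive (?J r)"
    unfolding nonexpansive_def using nonexp[OF assms(4)] by (intro lipschitz_onI) simp_all
  ultimately show ?thesis using single[OF assms(4)] shift by blast
qed

end
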